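(* Let $a_1,a_2\in D$ be nonzero pure quaternions with $|2a_1|\ge|a_2|$ and $N(a_2)\in N(a_1)k^{*2}$, and let $t$ be the integer with $\nu(\pi^t)=\nu(a_2)-\nu(a_1)$. Say that $r\in\mathcal{O}_D$ satisfies the $k$-star conditions if $\left(\frac{N(1-r),\,-N(a_1)}{\mathfrak{p}}\right)=-1$, $N(z)N(a_1)\in k^{*2}$ and $N(z)N(\pi^ta_1)^{-1}\in\mathcal{O}_k$, where $z=a_1-ra_1\bar r$. Let $e$ be the ramification index of $k/\mathbb{Q}_2$, $u=t+6e$, and let $\mathcal{S}\subseteq\mathcal{O}_k$ be any finite set of representatives of $\mathcal{O}_k/\pi^u\mathcal{O}_k$. Then there exists $r\in\mathcal{O}_D$ satisfying the $k$-star conditions if and only if there exists $\alpha\in\mathcal{S}\oplus\mathcal{S}\omega\oplus\mathcal{S}i\oplus\mathcal{S}i\omega\subseteq\mathcal{O}_D$ satisfying them.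
   Context: $k$ is a dyadic local field of characteristic $0$, $\mathcal{O}_k$ its integers, $\pi$ a uniformizer, $\nu_k$ its normalized valuation, $\left(\frac{x,y}{\mathfrak{p}}\right)$ the Hilbert symbol of $k$. $\Delta\in\mathcal{O}_k^*$ is a unit of minimal quadratic defect ($\Delta=1+4\delta$, $\delta\in\mathcal{O}_k^*$). $D=\left(\frac{\pi,\Delta}{k}\right)$ is the quaternion division algebra with basis $1,i,j,ij$, $i^2=\pi$, $j^2=\Delta$, $ij=-ji$; $\omega=(1+j)/2$. $N$ is the reduced norm, $q\mapsto\bar q$ the canonical involution, $|q|:=|N(q)|_k$, $\nu(q):=\nu_k(N(q))$, and $\mathcal{O}_D=\{q:|q|\le1\}=\mathcal{O}_k\oplus\mathcal{O}_k\omega\oplus\mathcal{O}_ki\oplus\mathcal{O}_ki\omega$. *)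

theory Defs
  imports Complex_Main
begin

section \<open>Dyadic local fields of characteristic 0, via a normalized discrete valuation\<close>

text \<open>The field k is a type of class field_char_0 (characteristic 0). A discrete valuation
 v :: k => int is only meaningful on nonzero elements; zero is treated separately
 (informally v 0 = +infinity).\<close>

definition vge :: "('k::field \<Rightarrow> int) \<Rightarrow> 'k \<Rightarrow> int \<Rightarrow> bool" where
  "vge v x n \<longleftrightarrow> x = 0 \<or> v x \<ge> n"   \<comment> \<open>informally: v(x) >= n, with v(0) = infinity\<close>

definition intk :: "('k::field \<Rightarrow> int) \<Rightarrow> 'k set" where
  "intk v = {x. vge v x 0}"   \<comment> \<open>the ring of integers O_k\<close>

definition unitk :: "('k::field \<Rightarrow> int) \<Rightarrow> 'k \<Rightarrow> bool" where
  "unitk v x \<longleftrightarrow> x \<noteq> 0 \<and> v x = 0"   \<comment> \<open>O_k^*\<close>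

definition dyadic_local_field :: "('k::field_char_0 \<Rightarrow> int) \<Rightarrow> bool" where
  "dyadic_local_field v \<longleftrightarrow>
     \<comment> \<open>discrete valuation, normalized (surjective onto Z)\<close>
     (\<forall>x y. x \<noteq> 0 \<longrightarrow> y \<noteq> 0 \<longrightarrow> v (x * y) = v x + v y) \<and>
     (\<forall>x y. x \<noteq> 0 \<longrightarrow> y \<noteq> 0 \<longrightarrow> x + y \<noteq> 0 \<longrightarrow> v (x + y) \<ge> min (v x) (v y)) \<and>
     (\<exists>p. p \<noteq> 0 \<and> v p = 1) \<and>
     \<comment> \<open>complete with respect to the valuation\<close>
     (\<forall>f :: nat \<Rightarrow> 'k. (\<forall>n::int. \<exists>N. \<forall>m\<ge>N. \<forall>m'\<ge>N. vge v (f m - f m') n) \<longrightarrow>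
        (\<exists>L. \<forall>n::int. \<exists>N. \<forall>m\<ge>N. vge v (f m - L) n)) \<and>
     \<comment> \<open>finite residue field O_k / pi O_k\<close>
     (\<exists>F. finite F \<and> F \<subseteq> intk v \<and> (\<forall>x\<in>intk v. \<exists>s\<in>F. vge v (x - s) 1)) \<and>
     \<comment> \<open>dyadic: residue characteristic 2\<close>
     v 2 > 0"

text \<open>Ramification index of k over Q_2 (v is normalized, so e = v(2)).\<close>
definition ram_index :: "('k::field \<Rightarrow> int) \<Rightarrow> int" where
  "ram_index v = v 2"

definition is_square :: "'k::field \<Rightarrow> bool" where
  "is_square x \<longleftrightarrow> (\<exists>y. x = y\<^sup>2)"

definition nonzero_square :: "'k::field \<Rightarrow> bool" where
  "nonzero_square x \<longleftrightarrow> (\<exists>y. y \<noteq> 0 \<and> x = y\<^sup>2)"   \<comment> \<open>x \<in> k^{*2}\<close>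

text \<open>Quadratic defect d(x) = intersection over y of (x - y^2) O_k. A unit Delta has minimal
 quadratic defect iff d(Delta) = 4 O_k, i.e. sup_y v(Delta - y^2) = v(4) and this sup is attained.\<close>
definition min_quad_defect_unit :: "('k::field \<Rightarrow> int) \<Rightarrow> 'k \<Rightarrow> bool" where
  "min_quad_defect_unit v D \<longleftrightarrow> unitk v D \<and>
     (\<forall>y. D - y\<^sup>2 \<noteq> 0 \<and> v (D - y\<^sup>2) \<le> v 4) \<and> (\<exists>y. D - y\<^sup>2 \<noteq> 0 \<and> v (D - y\<^sup>2) = v 4)"

text \<open>Hilbert symbol of k: 1 if z^2 = a x^2 + b y^2 has a nontrivial solution, else -1.\<close>
definition hilbert :: "'k::field \<Rightarrow> 'k \<Rightarrow> int" where
  "hilbert a b = (if \<exists>x y z. (x, y, z) \<noteq> (0, 0, 0) \<and> z\<^sup>2 = a * x\<^sup>2 + b * y\<^sup>2 then 1 else -1)"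

section \<open>The quaternion algebra (pi, Delta / k), coordinates w.r.t. 1, i, j, ij\<close>

datatype 'k quat = Q 'k 'k 'k 'k

definition qadd :: "'k::field quat \<Rightarrow> 'k quat \<Rightarrow> 'k quat" where
  "qadd p q = (case p of Q x0 x1 x2 x3 \<Rightarrow> case q of Q y0 y1 y2 y3 \<Rightarrow>
      Q (x0 + y0) (x1 + y1) (x2 + y2) (x3 + y3))"

definition qsub :: "'k::field quat \<Rightarrow> 'k quat \<Rightarrow> 'k quat" where
  "qsub p q = (case p of Q x0 x1 x2 x3 \<Rightarrow> case q of Q y0 y1 y2 y3 \<Rightarrow>
      Q (x0 - y0) (x1 - y1) (x2 - y2) (x3 - y3))"

text \<open>Multiplication with i^2 = a (= pi), j^2 = b (= Delta), ij = -ji.\<close>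
definition qmul :: "'k::field \<Rightarrow> 'k \<Rightarrow> 'k quat \<Rightarrow> 'k quat \<Rightarrow> 'k quat" where
  "qmul a b p q = (case p of Q x0 x1 x2 x3 \<Rightarrow> case q of Q y0 y1 y2 y3 \<Rightarrow>
      Q (x0*y0 + a*x1*y1 + b*x2*y2 - a*b*x3*y3)
        (x0*y1 + x1*y0 - b*x2*y3 + b*x3*y2)
        (x0*y2 + x2*y0 + a*x1*y3 - a*x3*y1)
        (x0*y3 + x3*y0 + x1*y2 - x2*y1))"

definition qconj :: "'k::field quat \<Rightarrow> 'k quat" where
  "qconj p = (case p of Q x0 x1 x2 x3 \<Rightarrow> Q x0 (-x1) (-x2) (-x3))"

text \<open>Reduced norm.\<close>
definition qnorm :: "'k::field \<Rightarrow> 'k \<Rightarrow> 'k quat \<Rightarrow> 'k" where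
  "qnorm a b p = (case p of Q x0 x1 x2 x3 \<Rightarrow> x0\<^sup>2 - a*x1\<^sup>2 - b*x2\<^sup>2 + a*b*x3\<^sup>2)"

definition scal :: "'k::field \<Rightarrow> 'k quat" where
  "scal c = Q c 0 0 0"

definition pure :: "'k::field quat \<Rightarrow> bool" where
  "pure p \<longleftrightarrow> (case p of Q x0 x1 x2 x3 \<Rightarrow> x0 = 0)"

definition qi :: "'k::field quat" where "qi = Q 0 1 0 0"
definition qomega :: "'k::field quat" where "qomega = Q (1/2) 0 (1/2) 0"   \<comment> \<open>(1+j)/2\<close>

text \<open>nu(q) = v(N(q)) (for q nonzero).\<close>
definition qnu :: "('k::field \<Rightarrow> int) \<Rightarrow> 'k \<Rightarrow> 'k \<Rightarrow> 'k quat \<Rightarrow> int" where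
  "qnu v a b q = v (qnorm a b q)"

text \<open>O_D = {q. |q| <= 1} = {q. v(N q) >= 0} (with N q = 0 allowed).\<close>
definition intD :: "('k::field \<Rightarrow> int) \<Rightarrow> 'k \<Rightarrow> 'k \<Rightarrow> 'k quat set" where
  "intD v a b = {q. vge v (qnorm a b q) 0}"

text \<open>S + S omega + S i + S i omega.\<close>
definition lattice_span :: "'k::field \<Rightarrow> 'k \<Rightarrow> 'k set \<Rightarrow> 'k quat set" where
  "lattice_span a b S = {qadd (qadd (scal s0) (qmul a b (scal s1) qomega))
                              (qadd (qmul a b (scal s2) qi) (qmul a b (scal s3) (qmul a b qi qomega)))
                         | s0 s1 s2 s3. s0 \<in> S \<and> s1 \<in> S \<and> s2 \<in> S \<and> s3 \<in> S}"

text \<open>S is a (complete, irredundant) system of representatives of O_k / pi^u O_k.\<close>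
definition repr_system :: "('k::field \<Rightarrow> int) \<Rightarrow> int \<Rightarrow> 'k set \<Rightarrow> bool" where
  "repr_system v u S \<longleftrightarrow> S \<subseteq> intk v \<and> (\<forall>x\<in>intk v. \<exists>!s. s \<in> S \<and> vge v (x - s) u)"

text \<open>The k-star conditions for r, with z = a1 - r a1 rbar.\<close>
definition kstar :: "('k::field \<Rightarrow> int) \<Rightarrow> 'k \<Rightarrow> 'k \<Rightarrow> 'k quat \<Rightarrow> int \<Rightarrow> 'k quat \<Rightarrow> bool" where
  "kstar v a b a1 t r \<longleftrightarrow>
     (let z = qsub a1 (qmul a b (qmul a b r a1) (qconj r)) in
       hilbert (qnorm a b (qsub (scal 1) r)) (- qnorm a b a1) = -1 \<and>
       nonzero_square (qnorm a b z * qnorm a b a1) \<and>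
       qnorm a b z * inverse (qnorm a b (qmul a b (scal (a powi t)) a1)) \<in> intk v)"

end

theory Submission
  imports Defs
begin

text \<open>Write \<open>m = N(a1)\<close> and \<open>r = c0 + c1 a1 + d\<close> with \<open>d\<close> orthogonal to \<open>1\<close> and \<open>a1\<close>, and put
  \<open>n = N(r)\<close>, \<open>B = N(d)\<close>. Then \<open>N(z) = m ((n - 1)\<^sup>2 + 4 B)\<close>, so the second star condition reads
  \<open>(n - 1)\<^sup>2 + 4 B = w\<^sup>2\<close> with \<open>w \<noteq> 0\<close>, and the first one says that \<open>N(1 - r)\<close> is not a norm
  from \<open>k(a1)\<close>. The identity \<open>N(1 - r) N(1 + r) = w\<^sup>2 + 4 c1\<^sup>2 m\<close> shows that then \<open>N(1 + r)\<close>
  is not a norm either. If \<open>v w \<ge> 5 e\<close> or \<open>v (N(1 - r)) \<ge> 8 e\<close>, the local square theorem forces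
  \<open>N(1 + r)\<close> to be a norm. Hence both valuations are bounded, and by the
  local square theorem again every \<open>\<alpha>\<close> congruent to \<open>r\<close> modulo \<open>\<pi>\<^sup>u\<close> satisfies the star conditions
  whenever \<open>r\<close> does.\<close>

section \<open>Valuation and local squares\<close>

locale dyadic =
  fixes v :: "'k::field_char_0 \<Rightarrow> int"
  assumes dyadic: "dyadic_local_field v"
begin

abbreviation e :: int where "e \<equiv> v 2"

lemma val_mult: "x \<noteq> 0 \<Longrightarrow> y \<noteq> 0 \<Longrightarrow> v (x * y) = v x + v y"
  using dyadic unfolding dyadic_local_field_def by blast

lemma val_add: "x \<noteq> 0 \<Longrightarrow> y \<noteq> 0 \<Longrightarrow> x + y \<noteq> 0 \<Longrightarrow> min (v x) (v y) \<le> v (x + y)"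
  using dyadic unfolding dyadic_local_field_def by blast

lemma e_pos: "0 < e"
  using dyadic unfolding dyadic_local_field_def by blast

lemma complete:
  fixes f :: "nat \<Rightarrow> 'k"
  assumes "\<And>n::int. \<exists>N. \<forall>i\<ge>N. \<forall>j\<ge>N. vge v (f i - f j) n"
  shows "\<exists>L. \<forall>n::int. \<exists>N. \<forall>i\<ge>N. vge v (f i - L) n"
  using dyadic assms unfolding dyadic_local_field_def by blast

lemma val_one [simp]: "v 1 = 0"
  using val_mult[of 1 1] by simp

lemma val_minus [simp]: "v (- x) = v x"
proof (cases "x = 0")
  case False
  have "v (- 1) = 0" using val_mult[of "-1" "-1"] by simp
  then show ?thesis using val_mult[of "-1" x] False by simp
qed simp

lemma val_square: "x \<noteq> 0 \<Longrightarrow> v (x\<^sup>2) = 2 * v x"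
  by (simp add: power2_eq_square val_mult)

lemma val_divide: "x \<noteq> 0 \<Longrightarrow> y \<noteq> 0 \<Longrightarrow> v (x / y) = v x - v y"
  using val_mult[of "x / y" y] by simp

lemma val_four [simp]: "v 4 = 2 * e"
  using val_square[of 2] by simp

lemma val_power_int: "x \<noteq> 0 \<Longrightarrow> v (x powi n) = n * v x"
proof (induction n rule: int_induct[where k = 0])
  case base then show ?case by simp
next
  case (step1 i)
  then show ?case by (simp add: power_int_add val_mult algebra_simps)
next
  case (step2 i)
  then show ?case by (simp add: power_int_diff val_divide algebra_simps)
qed

section \<open>The filtration of \<open>k\<close> by valuation\<close>

lemma vge_zero [simp]: "vge v 0 n" by (simp add: vge_def)

lemma vge_mono: "vge v x n \<Longrightarrow> n' \<le> n \<Longrightarrow> vge v x n'"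
  by (auto simp: vge_def)

lemma vge_add: "vge v x n \<Longrightarrow> vge v y n \<Longrightarrow> vge v (x + y) n"
  using val_add[of x y] by (cases "x = 0"; cases "y = 0"; cases "x + y = 0") (auto simp: vge_def)

lemma vge_minus [simp]: "vge v (- x) n \<longleftrightarrow> vge v x n"
  by (auto simp: vge_def)

lemma vge_diff: "vge v x n \<Longrightarrow> vge v y n \<Longrightarrow> vge v (x - y) n"
  using vge_add[of x n "- y"] by simp

lemma vge_mult: "vge v x i \<Longrightarrow> vge v y j \<Longrightarrow> vge v (x * y) (i + j)"
  by (cases "x = 0"; cases "y = 0") (auto simp: vge_def val_mult)

lemma vge_mult_le: "vge v x i \<Longrightarrow> vge v y j \<Longrightarrow> n \<le> i + j \<Longrightarrow> vge v (x * y) n"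
  by (blast intro: vge_mono vge_mult)

lemma vge_square: "vge v x i \<Longrightarrow> n \<le> 2 * i \<Longrightarrow> vge v (x\<^sup>2) n"
  by (simp add: power2_eq_square vge_mult_le)

lemma vge_divide_iff: "y \<noteq> 0 \<Longrightarrow> vge v (x / y) n \<longleftrightarrow> vge v x (n + v y)"
  by (cases "x = 0") (auto simp: vge_def val_divide)

lemma vge_val [simp]: "vge v x (v x)" by (simp add: vge_def)

lemma vge_all_imp_zero: "(\<And>n. vge v x n) \<Longrightarrow> x = 0"
  unfolding vge_def by (metis zle_add1_eq_le less_irrefl)

lemma val_add_dominant:
  assumes "x \<noteq> 0" "vge v y (v x + 1)"
  shows "x + y \<noteq> 0" "v (x + y) = v x"
proof -
  show nz: "x + y \<noteq> 0"
  proof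
    assume "x + y = 0"
    then have "y = - x" by (metis minus_unique)
    then show False using assms by (auto simp: vge_def)
  qed
  show "v (x + y) = v x"
  proof (cases "y = 0")
    case False
    then show ?thesis
      using assms nz val_add[of x y] val_add[of "x + y" "- y"] by (auto simp: vge_def)
  qed simp
qed

text \<open>The map sending \<open>p\<close> to \<open>c - p\<^sup>2\<close> contracts the maximal
  ideal: a difference of squares has the sum as a factor, so each step of the iteration gains one in
  valuation. Completeness gives a limit, which is a fixed point.\<close>

lemma artin_schreier_root:
  assumes c: "vge v c 1"
  shows "\<exists>p. p\<^sup>2 + p = c \<and> vge v p 1"
proof -
  define f where "f = rec_nat 0 (\<lambda>_ p. c - p\<^sup>2)"
  have f0: "f 0 = 0" and fS: "\<And>i. f (Suc i) = c - (f i)\<^sup>2" by (simp_all add: f_def)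
  have f1: "vge v (f i) 1" for i
    by (induction i) (auto simp: f0 fS intro!: vge_diff c vge_square)
  have step: "vge v (f (Suc i) - f i) (int i + 1)" for i
  proof (induction i)
    case 0 then show ?case by (simp add: f0 fS c)
  next
    case (Suc i)
    have "f (Suc (Suc i)) - f (Suc i) = (f i)\<^sup>2 - (f (Suc i))\<^sup>2"
      by (simp add: fS)
    also have "\<dots> = - ((f (Suc i) - f i) * (f (Suc i) + f i))"
      by (simp add: power2_eq_square algebra_simps)
    finally have "f (Suc (Suc i)) - f (Suc i) = - ((f (Suc i) - f i) * (f (Suc i) + f i))" .
    moreover have "vge v ((f (Suc i) - f i) * (f (Suc i) + f i)) (int (Suc i) + 1)"
      by (rule vge_mult_le[OF Suc vge_add[OF f1 f1]]) simp
    ultimately show ?case by simp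
  qed
  have dist: "vge v (f (i + j) - f i) (int i + 1)" for i j
  proof (induction j)
    case (Suc j)
    have "vge v (f (Suc (i + j)) - f (i + j)) (int i + 1)"
      by (rule vge_mono[OF step]) simp
    from vge_add[OF this Suc] show ?case by simp
  qed simp
  have "\<exists>L. \<forall>n. \<exists>N. \<forall>i\<ge>N. vge v (f i - L) n"
  proof (intro complete exI allI impI)
    fix n :: int and i j assume "nat n \<le> i" "nat n \<le> j"
    then have "vge v (f i - f (nat n)) n" "vge v (f j - f (nat n)) n"
      using dist[of "nat n" "i - nat n"] dist[of "nat n" "j - nat n"]
      by (auto intro: vge_mono)
    from vge_diff[OF this] show "vge v (f i - f j) n" by simp
  qed
  then obtain L where L: "\<And>n. \<exists>N. \<forall>i\<ge>N. vge v (f i - L) n" by blast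
  have L1: "vge v L 1"
  proof -
    obtain i where "vge v (f i - L) 1" using L[of 1] by blast
    from vge_diff[OF f1[of i] this] show ?thesis by simp
  qed
  have "L\<^sup>2 + L - c = 0"
  proof (rule vge_all_imp_zero)
    fix n
    obtain N where N: "\<And>i. i \<ge> N \<Longrightarrow> vge v (f i - L) n" using L[of n] by blast
    have "L\<^sup>2 + L - c = - ((f N - L) * (f N + L)) - (f (Suc N) - L)"
      by (simp add: fS power2_eq_square algebra_simps)
    moreover have "vge v ((f N - L) * (f N + L)) n"
      by (rule vge_mult_le[OF N vge_add[OF f1 L1]]) auto
    then have "vge v (- ((f N - L) * (f N + L)) - (f (Suc N) - L)) n"
      by (intro vge_diff N) (simp_all only: vge_minus le_SucI order_refl)
    ultimately show "vge v (L\<^sup>2 + L - c) n" by metis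
  qed
  then show ?thesis using L1 by (intro exI[of _ L]) simp
qed

text \<open>With \<open>y = 1 + 2 * p\<close> the equation \<open>1 + x = y\<^sup>2\<close> becomes
  \<open>p\<^sup>2 + p = x / 4\<close>, whose right side lies in the maximal ideal.\<close>

lemma local_square:
  assumes "vge v x (2 * e + 1)"
  obtains y where "1 + x = y\<^sup>2" "y \<noteq> 0" "v y = 0"
proof -
  have "vge v (x / 4) 1" using assms by (simp add: vge_divide_iff add.commute)
  then obtain p where p: "p\<^sup>2 + p = x / 4" "vge v p 1" using artin_schreier_root by blast
  have "vge v (2 * p) 1" by (rule vge_mult_le[OF vge_val p(2)]) (use e_pos in simp)
  then have "1 + 2 * p \<noteq> 0" "v (1 + 2 * p) = 0"
    using val_add_dominant[of 1 "2 * p"] by auto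
  moreover have "1 + x = (1 + 2 * p)\<^sup>2"
  proof -
    have "x = 4 * (p\<^sup>2 + p)" unfolding p(1) by simp
    then show ?thesis by (simp add: power2_eq_square algebra_simps)
  qed
  ultimately show thesis using that by blast
qed

end

section \<open>Norms from the quadratic extension by a square root of \<open>-m\<close>\<close>

definition norm_form :: "'k::field \<Rightarrow> 'k \<Rightarrow> bool" where
  "norm_form m c \<longleftrightarrow> (\<exists>x y. c = x\<^sup>2 + m * y\<^sup>2)"

lemma norm_formI: "c = x\<^sup>2 + m * y\<^sup>2 \<Longrightarrow> norm_form m c"
  unfolding norm_form_def by blast

lemma norm_form_mult:
  assumes "norm_form m c" "norm_form m d" shows "norm_form m (c * d)"
proof -
  obtain x y x' y' where "c = x\<^sup>2 + m * y\<^sup>2" "d = x'\<^sup>2 + m * y'\<^sup>2"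
    using assms unfolding norm_form_def by blast
  then have "c * d = (x * x' - m * y * y')\<^sup>2 + m * (x * y' + y * x')\<^sup>2"
    by (simp add: power2_eq_square algebra_simps)
  then show ?thesis by (rule norm_formI)
qed

lemma norm_form_square: "norm_form m (y\<^sup>2)"
  by (rule norm_formI[of _ y _ 0]) simp

text \<open>Up to the square of \<open>1 / d\<close>, dividing by \<open>d\<close> is multiplying by
  \<open>d\<close>.\<close>

lemma norm_form_cancel:
  assumes "norm_form m (c * d)" "norm_form m d" "d \<noteq> 0" shows "norm_form m c"
proof -
  have "norm_form m (c * d * d * (1 / d)\<^sup>2)"
    by (intro norm_form_mult norm_form_square assms)
  then show ?thesis using assms(3) by (simp add: power2_eq_square)
qed

lemma hilbert_eq_minus_one_iff:
  fixes m c :: "'k::field_char_0"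
  assumes m: "m \<noteq> 0"
  shows "hilbert c (- m) = -1 \<longleftrightarrow> \<not> norm_form m c"
proof -
  have "(\<exists>x y z. (x, y, z) \<noteq> (0, 0, 0) \<and> z\<^sup>2 = c * x\<^sup>2 + (- m) * y\<^sup>2) \<longleftrightarrow> norm_form m c"
    (is "?L \<longleftrightarrow> _")
  proof
    assume ?L
    then obtain x y z where nz: "(x, y, z) \<noteq> (0, 0, 0)" and eq: "z\<^sup>2 = c * x\<^sup>2 - m * y\<^sup>2" by auto
    show "norm_form m c"
    proof (cases "x = 0")
      case False
      then have "c = (z / x)\<^sup>2 + m * (y / x)\<^sup>2" using eq by (simp add: field_simps)
      then show ?thesis by (rule norm_formI)
    next
      \<comment> \<open>Here \<open>-m\<close> is a square, so the norm form is hyperbolic and represents everything.\<close>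
      case True
      then have y: "y \<noteq> 0" using nz eq by auto
      then have z: "z \<noteq> 0" using True eq m by auto
      have "m = - (z / y)\<^sup>2" using True eq y by (simp add: field_simps)
      \<comment> \<open>The witnesses come from
        \<open>c = ((c + 1) / 2)\<^sup>2 - ((c - 1) / 2)\<^sup>2\<close>; the factor
        \<open>y / z\<close> turns \<open>m\<close> into \<open>-1\<close>.\<close>
      then have "m * ((c - 1) / 2 * (y / z))\<^sup>2 = - ((c - 1) / 2)\<^sup>2"
        using y z by (simp add: power_mult_distrib power_divide)
      then have "c = ((c + 1) / 2)\<^sup>2 + m * ((c - 1) / 2 * (y / z))\<^sup>2"
        by (simp add: field_simps power2_eq_square)
      then show ?thesis by (rule norm_formI)
    qed
  next
    assume "norm_form m c"
    then obtain x y where "c = x\<^sup>2 + m * y\<^sup>2" unfolding norm_form_def by blast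
    then show ?L by (intro exI[of _ 1] exI[of _ y] exI[of _ x]) simp
  qed
  then show ?thesis by (simp add: hilbert_def)
qed

context dyadic
begin

text \<open>In the next two lemmas \<open>P = N(1 - r)\<close>, and \<open>1 + n + 2 c0 = N(1 + r)\<close>.\<close>

lemma norm_form_if_deep_discriminant:
  fixes m n c0 c1 w :: 'k
  defines "B \<equiv> n - c0\<^sup>2 - m * c1\<^sup>2" and "P \<equiv> 1 + n - 2 * c0"
  assumes disc: "w\<^sup>2 = (n - 1)\<^sup>2 + 4 * B" and w: "vge v w (5 * e)"
    and nsq: "\<not> is_square (- B)"
  shows "norm_form m P"
proof -
  define P' where "P' = 1 + n + 2 * c0"
  define x where "x = 1 - c0"
  \<comment> \<open>Otherwise \<open>w\<^sup>2\<close> is negligible against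
    \<open>(n - 1)\<^sup>2\<close>, and their difference makes \<open>- 4 * B\<close> a square. The
    strict inequality supplies the \<open>+ 1\<close> in \<open>e + 1\<close>.\<close>
  have n1: "vge v (n - 1) (4 * e)"
  proof (rule ccontr)
    assume "\<not> ?thesis"
    then have nz: "n - 1 \<noteq> 0" and "v (n - 1) < 4 * e" by (auto simp: vge_def)
    then have "vge v (w / (n - 1)) (e + 1)"
      using w by (auto simp: vge_divide_iff intro: vge_mono)
    then have "vge v (- (w / (n - 1))\<^sup>2) (2 * e + 1)"
      unfolding vge_minus by (rule vge_square) simp
    then obtain y where y: "1 + - (w / (n - 1))\<^sup>2 = y\<^sup>2" by (rule local_square)
    have "(y * (n - 1))\<^sup>2 = (1 + - (w / (n - 1))\<^sup>2) * (n - 1)\<^sup>2"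
      by (simp only: y power_mult_distrib)
    also have "\<dots> = (n - 1)\<^sup>2 - w\<^sup>2"
      using nz by (simp add: power_divide left_diff_distrib)
    finally have "(n - 1)\<^sup>2 - w\<^sup>2 = (y * (n - 1))\<^sup>2" by simp
    moreover have "- B = ((n - 1)\<^sup>2 - w\<^sup>2) / 4" unfolding disc by simp
    ultimately have "- B = (y * (n - 1) / 2)\<^sup>2" by (simp add: power_divide)
    then show False using nsq unfolding is_square_def by blast
  qed
  have "vge v (4 * B) (8 * e)"
  proof -
    have "4 * B = w\<^sup>2 - (n - 1)\<^sup>2" using disc by simp
    then show ?thesis
      using vge_diff[OF vge_square[OF w] vge_square[OF n1]] e_pos by simp
  qed
  then have B: "vge v B (6 * e)" using vge_divide_iff[of 4 "4 * B" "6 * e"] by simp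
  \<comment> \<open>This splits \<open>N(1 - r)\<close> along \<open>1\<close>, \<open>a1\<close>
    and \<open>d\<close>. If \<open>v P < 4 * e\<close>, then \<open>B\<close> is negligible and
    \<open>P\<close> is a norm up to a square factor.\<close>
  have Pdec: "P = x\<^sup>2 + m * c1\<^sup>2 + B"
    unfolding P_def B_def x_def by (simp add: power2_eq_square algebra_simps)
  show ?thesis
  proof (cases "vge v P (4 * e)")
    case False
    then have nz: "P \<noteq> 0" and "v P < 4 * e" by (auto simp: vge_def)
    then have "vge v (- (B / P)) (2 * e + 1)"
      unfolding vge_minus using B by (auto simp: vge_divide_iff intro: vge_mono)
    then obtain y where y: "1 + - (B / P) = y\<^sup>2" "y \<noteq> 0" by (rule local_square)
    then have "x\<^sup>2 + m * c1\<^sup>2 = P * y\<^sup>2"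
      using nz Pdec by (simp add: field_simps flip: y(1))
    then have "norm_form m (P * y\<^sup>2)" by (metis norm_formI)
    then show ?thesis by (rule norm_form_cancel) (use y norm_form_square in auto)
  next
    case P: True
    have "2 * x = P - (n - 1)" by (simp add: P_def x_def)
    then have "vge v (2 * x) (4 * e)" using P n1 by (simp add: vge_diff)
    then have "vge v x (3 * e)" using vge_divide_iff[of 2 "2 * x" "3 * e"] by simp
    then have x2: "vge v (x\<^sup>2) (6 * e)" by (rule vge_square) simp
    have "m * c1\<^sup>2 = P - x\<^sup>2 - B" using Pdec by simp
    then have mc: "vge v (m * c1\<^sup>2) (4 * e)"
      using P x2 B e_pos by (auto intro!: vge_diff intro: vge_mono)
    \<comment> \<open>Since \<open>P + P' = 4 + 2 * (n - 1)\<close>, \<open>P'\<close> contains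
      \<open>- m * c1\<^sup>2\<close>. Removing it twice leaves one copy with a plus sign, so that
      \<open>P'\<close> becomes a square plus \<open>m * c1\<^sup>2\<close>.\<close>
    define \<epsilon> where "\<epsilon> = (2 * (n - 1) - x\<^sup>2 - B - 2 * (m * c1\<^sup>2)) / 4"
    have "vge v (2 * (n - 1)) (5 * e)" "vge v (2 * (m * c1\<^sup>2)) (5 * e)"
      using vge_mult[OF vge_val n1, of 2] vge_mult[OF vge_val mc, of 2] by simp_all
    then have "vge v (2 * (n - 1) - x\<^sup>2 - B - 2 * (m * c1\<^sup>2)) (5 * e)"
      using x2 B e_pos by (auto intro!: vge_diff intro: vge_mono)
    then have eps: "vge v \<epsilon> (3 * e)" by (simp add: \<epsilon>_def vge_divide_iff)
    then have "vge v \<epsilon> (2 * e + 1)" by (rule vge_mono) (use e_pos in simp)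
    then obtain y where y: "1 + \<epsilon> = y\<^sup>2" by (rule local_square)
    have P'_eq: "P' = 4 * (1 + \<epsilon>) + m * c1\<^sup>2"
    proof -
      have "P' = 4 + 2 * (n - 1) - P" by (simp add: P'_def P_def)
      moreover have "4 * \<epsilon> = 2 * (n - 1) - x\<^sup>2 - B - 2 * (m * c1\<^sup>2)" by (simp add: \<epsilon>_def)
      ultimately show ?thesis by (simp only: Pdec distrib_left) (simp add: algebra_simps)
    qed
    have "P' = (2 * y)\<^sup>2 + m * c1\<^sup>2" unfolding P'_eq y by (simp add: power_mult_distrib)
    then have "norm_form m P'" by (rule norm_formI)
    moreover have "P' \<noteq> 0"
    proof -
      have "vge v (4 * \<epsilon>) (2 * e + 1)"
        by (rule vge_mult_le[OF vge_val eps]) (use e_pos in simp)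
      moreover have "vge v (m * c1\<^sup>2) (2 * e + 1)"
        by (rule vge_mono[OF mc]) (use e_pos in simp)
      ultimately have "vge v (4 * \<epsilon> + m * c1\<^sup>2) (v 4 + 1)" by (simp add: vge_add)
      then have "4 + (4 * \<epsilon> + m * c1\<^sup>2) \<noteq> 0" using val_add_dominant(1)[of 4] by simp
      then show ?thesis by (simp add: P'_eq algebra_simps)
    qed
    moreover have "P * P' = w\<^sup>2 + m * (2 * c1)\<^sup>2"
      unfolding disc B_def P_def P'_def by (simp add: power2_eq_square algebra_simps)
    then have "norm_form m (P * P')" by (rule norm_formI)
    ultimately show ?thesis using norm_form_cancel by blast
  qed
qed

text \<open>Here \<open>P' = 4 + P - 4 * (1 - c0)\<close> is so close to \<open>4\<close> that it is
  a nonzero square, and \<open>P * P'\<close> is a norm. The hypothesis \<open>tr\<close> bounds the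
  trace of \<open>1 - r\<close>.\<close>

lemma norm_form_if_deep_norm:
  fixes m n c0 c1 w :: 'k
  defines "P \<equiv> 1 + n - 2 * c0"
  assumes disc: "w\<^sup>2 = (n - 1)\<^sup>2 + 4 * (n - c0\<^sup>2 - m * c1\<^sup>2)"
    and P: "vge v P (8 * e)" and tr: "vge v (2 * (1 - c0)) (4 * e)"
  shows "norm_form m P"
proof -
  define P' where "P' = 1 + n + 2 * c0"
  define \<epsilon> where "\<epsilon> = (P - 2 * (2 * (1 - c0))) / 4"
  have "vge v (2 * (2 * (1 - c0))) (5 * e)" using vge_mult[OF vge_val tr, of 2] by simp
  then have "vge v (P - 2 * (2 * (1 - c0))) (5 * e)"
    using P e_pos by (auto intro!: vge_diff intro: vge_mono)
  then have "vge v \<epsilon> (3 * e)" by (simp add: \<epsilon>_def vge_divide_iff)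
  then have "vge v \<epsilon> (2 * e + 1)" by (rule vge_mono) (use e_pos in simp)
  then obtain y where y: "1 + \<epsilon> = y\<^sup>2" "y \<noteq> 0" by (rule local_square)
  have "P' = 4 * (1 + \<epsilon>)" by (simp add: P'_def P_def \<epsilon>_def field_simps)
  then have P': "P' = (2 * y)\<^sup>2" by (simp add: y power_mult_distrib)
  have "P * P' = w\<^sup>2 + m * (2 * c1)\<^sup>2"
    unfolding disc P_def P'_def by (simp add: power2_eq_square algebra_simps)
  then have "norm_form m (P * P')" by (rule norm_formI)
  then show ?thesis by (rule norm_form_cancel) (simp_all only: P' norm_form_square, simp add: y)
qed

end

section \<open>The quaternion algebra\<close>

definition qtr :: "'k::field quat \<Rightarrow> 'k" where
  "qtr p = (case p of Q x0 x1 x2 x3 \<Rightarrow> 2 * x0)"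

lemmas quat_defs = qadd_def qsub_def qmul_def qconj_def qnorm_def scal_def pure_def qtr_def

lemma qnorm_mult: "qnorm a b (qmul a b p q) = qnorm a b p * qnorm a b q"
  by (cases p; cases q) (simp add: quat_defs power2_eq_square algebra_simps)

lemma qnorm_conj [simp]: "qnorm a b (qconj p) = qnorm a b p"
  by (cases p) (simp add: quat_defs)

lemma qnorm_scal [simp]: "qnorm a b (scal c) = c\<^sup>2"
  by (simp add: quat_defs)

lemma qnorm_add: "qnorm a b (qadd p q) = qnorm a b p + qnorm a b q + qtr (qmul a b p (qconj q))"
  by (cases p; cases q) (simp add: quat_defs power2_eq_square algebra_simps)

lemma qnorm_sub: "qnorm a b (qsub p q) = qnorm a b p + qnorm a b q - qtr (qmul a b p (qconj q))"
  by (cases p; cases q) (simp add: quat_defs power2_eq_square algebra_simps)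

text \<open>The last bracket is the bilinear form of the norm at \<open>r\<close> and
  \<open>a1\<close>; this keeps the formula free of division by \<open>N(a1)\<close>.\<close>

lemma qnorm_star_vector:
  assumes "a1 = Q 0 y1 y2 y3" "r = Q x0 x1 x2 x3"
  shows "qnorm a b (qsub a1 (qmul a b (qmul a b r a1) (qconj r)))
    = qnorm a b a1 * ((qnorm a b r - 1)\<^sup>2 + 4 * (qnorm a b r - x0\<^sup>2))
      - 4 * (a * b * x3 * y3 - a * x1 * y1 - b * x2 * y2)\<^sup>2"
  unfolding assms by (simp add: quat_defs power2_eq_square) algebra

text \<open>As \<open>a1\<close> is pure, the two terms linear in \<open>h\<close> are
  \<open>q\<close> and minus its conjugate, for \<open>q\<close> the product of \<open>h\<close>,
  \<open>a1\<close> and the conjugate of \<open>r\<close>.\<close>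

lemma star_vector_perturb:
  assumes "pure a1"
  shows "qsub a1 (qmul a b (qmul a b (qadd r h) a1) (qconj (qadd r h)))
    = qsub (qsub a1 (qmul a b (qmul a b r a1) (qconj r)))
        (qadd (qsub (qmul a b (qmul a b h a1) (qconj r)) (qconj (qmul a b (qmul a b h a1) (qconj r))))
          (qmul a b (qmul a b h a1) (qconj h)))"
  using assms by (cases a1; cases r; cases h) (simp add: quat_defs algebra_simps)

section \<open>Anisotropy and valuation of the reduced norm\<close>

locale dyadic_quaternion = dyadic v for v :: "'k::field_char_0 \<Rightarrow> int" +
  fixes pi \<delta> Delta :: 'k
  assumes pi: "pi \<noteq> 0" "v pi = 1"
    and delta: "unitk v \<delta>" "Delta = 1 + 4 * \<delta>"
    and min_defect: "min_quad_defect_unit v Delta"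
begin

abbreviation N :: "'k quat \<Rightarrow> 'k" where "N \<equiv> qnorm pi Delta"
abbreviation mul :: "'k quat \<Rightarrow> 'k quat \<Rightarrow> 'k quat" where "mul \<equiv> qmul pi Delta"

lemma defect: "Delta - y\<^sup>2 \<noteq> 0" "v (Delta - y\<^sup>2) \<le> 2 * e"
  using min_defect unfolding min_quad_defect_unit_def by simp_all

lemma vge_delta: "vge v \<delta> 0" using delta by (simp add: unitk_def vge_def)

text \<open>With \<open>f = y - 1\<close>, either \<open>v f < e\<close> and
  \<open>f\<^sup>2\<close> dominates, or the valuation is at least \<open>2 * e\<close> and
  minimality of the defect makes it equal to \<open>2 * e\<close>.\<close>

lemma val_defect_even: "even (v (Delta - y\<^sup>2))"
proof -
  define f where "f = y - 1"
  have eq: "Delta - y\<^sup>2 = - f\<^sup>2 + (4 * \<delta> - 2 * f)"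
    by (simp add: delta f_def power2_eq_square algebra_simps)
  have d: "vge v (4 * \<delta>) (2 * e)" using vge_mult[OF vge_val[of 4] vge_delta] by simp
  show ?thesis
  proof (cases "vge v f e")
    case True
    have "vge v (2 * f) (2 * e)" using vge_mult[OF vge_val[of 2] True] by simp
    then have "vge v (Delta - y\<^sup>2) (2 * e)"
      unfolding eq using d by (intro vge_add vge_diff) (auto intro: vge_square[OF True])
    then have "v (Delta - y\<^sup>2) = 2 * e" using defect[of y] by (simp add: vge_def)
    then show ?thesis by simp
  next
    case False
    then have f: "f \<noteq> 0" "v f < e" by (auto simp: vge_def)
    have "vge v (4 * \<delta> - 2 * f) (2 * v f + 1)"
    proof (rule vge_diff)
      show "vge v (4 * \<delta>) (2 * v f + 1)" by (rule vge_mono[OF d]) (use f in simp)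
      show "vge v (2 * f) (2 * v f + 1)"
        by (rule vge_mult_le[OF vge_val vge_val]) (use f in simp)
    qed
    then have "v (- f\<^sup>2 + (4 * \<delta> - 2 * f)) = v (- f\<^sup>2)"
      using f by (intro val_add_dominant) (simp_all add: val_square)
    then show ?thesis using f by (simp add: eq val_square)
  qed
qed

lemma val_binary_even:
  assumes "x\<^sup>2 - Delta * y\<^sup>2 \<noteq> 0" shows "even (v (x\<^sup>2 - Delta * y\<^sup>2))"
proof (cases "y = 0")
  case True then show ?thesis using assms by (simp add: val_square)
next
  case False
  have "x\<^sup>2 - Delta * y\<^sup>2 = - ((Delta - (x / y)\<^sup>2) * y\<^sup>2)"
    using False by (simp add: field_simps)
  then have "v (x\<^sup>2 - Delta * y\<^sup>2) = v ((Delta - (x / y)\<^sup>2) * y\<^sup>2)" by (simp only: val_minus)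
  also have "\<dots> = v (Delta - (x / y)\<^sup>2) + 2 * v y"
    using False defect(1) by (subst val_mult) (simp_all add: val_square)
  finally show ?thesis using val_defect_even[of "x / y"] by simp
qed

text \<open>The elements \<open>x - y\<close> and \<open>2 * y\<close> are the coordinates of
  \<open>x + y j\<close> in the basis \<open>1\<close>, \<open>omega\<close>. The defect bounds the
  second; the factorization of \<open>x\<^sup>2 - y\<^sup>2\<close> then bounds the first.\<close>

lemma vge_binary:
  assumes "vge v (x\<^sup>2 - Delta * y\<^sup>2) (2 * i)"
  shows "vge v (2 * y) i" "vge v (x - y) i"
proof -
  show y: "vge v (2 * y) i"
  proof (cases "y = 0")
    case False
    have "Delta - (x / y)\<^sup>2 = - (x\<^sup>2 - Delta * y\<^sup>2) / y\<^sup>2"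
      using False by (simp add: diff_divide_distrib power_divide)
    moreover have "vge v (- (x\<^sup>2 - Delta * y\<^sup>2) / y\<^sup>2) (2 * i - 2 * v y)"
    proof (subst vge_divide_iff)
      show "vge v (- (x\<^sup>2 - Delta * y\<^sup>2)) (2 * i - 2 * v y + v (y\<^sup>2))"
        unfolding vge_minus using assms False by (simp add: val_square)
    qed (use False in simp)
    ultimately have "vge v (Delta - (x / y)\<^sup>2) (2 * i - 2 * v y)" by simp
    then have "i \<le> v 2 + v y" using defect[of "x / y"] by (simp add: vge_def)
    then show ?thesis using False by (simp add: vge_def val_mult)
  qed simp
  show "vge v (x - y) i"
  proof (rule ccontr)
    define a where "a = x - y"
    assume "\<not> vge v (x - y) i"
    then have a: "a \<noteq> 0" "v a < i" by (auto simp: vge_def a_def)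
    have eq: "a * (a + 2 * y) = (x\<^sup>2 - Delta * y\<^sup>2) + \<delta> * (2 * y)\<^sup>2"
      by (simp add: a_def delta power2_eq_square algebra_simps)
    have "vge v (\<delta> * (2 * y)\<^sup>2) (2 * i)"
      by (rule vge_mult_le[OF vge_delta vge_square[OF y order_refl]]) simp
    then have "vge v (a * (a + 2 * y)) (2 * i)" unfolding eq using assms by (rule vge_add[rotated])
    moreover have "vge v (2 * y) (v a + 1)" by (rule vge_mono[OF y]) (use a in simp)
    then have "a + 2 * y \<noteq> 0" "v (a + 2 * y) = v a" using val_add_dominant a by blast+
    ultimately show False using a by (simp add: vge_def val_mult)
  qed
qed

text \<open>The two binary parts of the norm have even, respectively odd, valuation, so they cannot cancel.\<close>

lemma vge_norm_coords:
  assumes "vge v (N (Q x0 x1 x2 x3)) (2 * i)"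
  shows "vge v (x0 - x2) i" "vge v (2 * x2) i" "vge v (x1 - x3) i" "vge v (2 * x3) i"
proof -
  define f g where "f = x0\<^sup>2 - Delta * x2\<^sup>2" and "g = x1\<^sup>2 - Delta * x3\<^sup>2"
  have ef: "f \<noteq> 0 \<Longrightarrow> even (v f)" and eg: "g \<noteq> 0 \<Longrightarrow> even (v g)"
    using val_binary_even by (auto simp: f_def g_def)
  have "N (Q x0 x1 x2 x3) = f - pi * g"
    by (simp add: f_def g_def qnorm_def algebra_simps)
  then have fg: "vge v (f - pi * g) (2 * i)" using assms by simp
  have pg: "g \<noteq> 0 \<Longrightarrow> v (pi * g) = 1 + v g" using pi by (simp add: val_mult)
  have f: "vge v f (2 * i)"
  proof (rule ccontr)
    assume "\<not> ?thesis"
    then have f: "f \<noteq> 0" "v f < 2 * i" by (auto simp: vge_def)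
    have "g \<noteq> 0" using f fg by (auto simp: vge_def)
    moreover have "v (pi * g) = v f"
    proof -
      have "vge v (- (f - pi * g)) (v f + 1)" unfolding vge_minus
        by (rule vge_mono[OF fg]) (use f in simp)
      from val_add_dominant(2)[OF f(1) this] show ?thesis by simp
    qed
    ultimately have "v f = 1 + v g" "even (v g)" using pg eg by auto
    then show False using ef[OF f(1)] by simp
  qed
  have "vge v (pi * g) (2 * i)" using vge_diff[OF f fg] by simp
  \<comment> \<open>Dividing by \<open>pi\<close> costs one in valuation; evenness of
    \<open>v g\<close> recovers it.\<close>
  then have g: "vge v g (2 * i)"
    using pi eg by (cases "g = 0") (auto simp: vge_def val_mult elim!: evenE)
  show "vge v (x0 - x2) i" "vge v (2 * x2) i" using vge_binary[OF f[unfolded f_def]] by auto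
  show "vge v (x1 - x3) i" "vge v (2 * x3) i" using vge_binary[OF g[unfolded g_def]] by auto
qed

text \<open>A zero norm satisfies every valuation bound, so all coordinates vanish: the algebra is a
  division algebra.\<close>

lemma norm_eq_zero: "N q = 0 \<longleftrightarrow> q = Q 0 0 0 0"
proof
  assume q: "N q = 0"
  obtain x0 x1 x2 x3 where Q: "q = Q x0 x1 x2 x3" by (cases q)
  have "vge v (N (Q x0 x1 x2 x3)) (2 * i)" for i using q Q by simp
  then have "x0 - x2 = 0" "2 * x2 = 0" "x1 - x3 = 0" "2 * x3 = 0"
    using vge_all_imp_zero vge_norm_coords by metis+
  then show "q = Q 0 0 0 0" using Q by simp
qed (simp add: qnorm_def)

lemma vge_trace:
  assumes "vge v (N q) (2 * i)" shows "vge v (qtr q) i"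
proof -
  obtain x0 x1 x2 x3 where Q: "q = Q x0 x1 x2 x3" by (cases q)
  have "vge v (2 * (x0 - x2)) i"
    using vge_norm_coords(1)[of x0 x1 x2 x3 i] assms e_pos
    by (intro vge_mult_le[OF vge_val[of 2]]) (auto simp: Q)
  moreover have "vge v (2 * x2) i" using vge_norm_coords(2) assms Q by blast
  ultimately have "vge v (2 * (x0 - x2) + 2 * x2) i" by (rule vge_add)
  then show ?thesis by (simp add: Q qtr_def algebra_simps)
qed

text \<open>A Cauchy-Schwarz bound for the polar form of the norm; it yields the ultrametric
  inequality for quaternions.\<close>

lemma vge_trace_mult:
  assumes "vge v (N p) i" "vge v (N q) j" "2 * l \<le> i + j"
  shows "vge v (qtr (mul p (qconj q))) l"
  by (rule vge_trace) (simp add: qnorm_mult vge_mult_le[OF assms])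

lemma vge_norm_add: "vge v (N p) i \<Longrightarrow> vge v (N q) i \<Longrightarrow> vge v (N (qadd p q)) i"
  by (simp add: qnorm_add vge_add vge_trace_mult)

lemma vge_norm_sub: "vge v (N p) i \<Longrightarrow> vge v (N q) i \<Longrightarrow> vge v (N (qsub p q)) i"
  by (simp add: qnorm_sub vge_add vge_diff vge_trace_mult)

text \<open>The quotient of the two norms is a perturbation of \<open>1\<close>. The trace term sees
  only half of the extra \<open>4 * e + 2\<close>, which is what \<open>local_square\<close>
  needs.\<close>

lemma norm_perturb:
  assumes p: "N p \<noteq> 0" and g: "vge v (N g) (v (N p) + 4 * e + 2)"
  obtains y where "N (qsub p g) = N p * y\<^sup>2" "y \<noteq> 0" "v y = 0"
proof -
  have "vge v (qtr (mul p (qconj g))) (v (N p) + 2 * e + 1)"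
    by (rule vge_trace_mult[OF vge_val g]) simp
  moreover have "vge v (N g) (v (N p) + 2 * e + 1)"
    by (rule vge_mono[OF g]) (use e_pos in simp)
  ultimately have "vge v ((N g - qtr (mul p (qconj g))) / N p) (2 * e + 1)"
    using p by (simp add: vge_divide_iff vge_diff algebra_simps)
  then obtain y where y: "1 + (N g - qtr (mul p (qconj g))) / N p = y\<^sup>2" "y \<noteq> 0" "v y = 0"
    by (rule local_square)
  have "N (qsub p g) = N p * y\<^sup>2"
    unfolding y(1)[symmetric] qnorm_sub using p by (simp add: field_simps)
  then show thesis using that y by blast
qed

subsection \<open>The lattice of integral quaternions\<close>

text \<open>The combination of \<open>1\<close>, \<open>omega\<close>, \<open>i\<close>,
  \<open>i omega\<close>, written in the basis \<open>1\<close>, \<open>i\<close>, \<open>j\<close>,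
  \<open>ij\<close>. Inverting it gives the coordinates bounded in
  \<open>vge_norm_coords\<close>.\<close>

definition lat :: "'k \<Rightarrow> 'k \<Rightarrow> 'k \<Rightarrow> 'k \<Rightarrow> 'k quat" where
  "lat s0 s1 s2 s3 = Q (s0 + s1 / 2) (s2 + s3 / 2) (s1 / 2) (s3 / 2)"

lemma lattice_span_eq:
  "lattice_span pi Delta S
    = {lat s0 s1 s2 s3 | s0 s1 s2 s3. s0 \<in> S \<and> s1 \<in> S \<and> s2 \<in> S \<and> s3 \<in> S}"
  by (simp add: lattice_span_def lat_def quat_defs qi_def qomega_def)

text \<open>In this basis the norm is a quadratic form with integral coefficients.\<close>

lemma vge_norm_lat:
  assumes "vge v s0 i" "vge v s1 i" "vge v s2 i" "vge v s3 i"
  shows "vge v (N (lat s0 s1 s2 s3)) (2 * i)"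
proof -
  have bin: "vge v (a\<^sup>2 + a * b - \<delta> * b\<^sup>2) (2 * i)" if "vge v a i" "vge v b i" for a b
    by (intro vge_add vge_diff vge_square[OF that(1)] vge_mult_le[OF that]
        vge_mult_le[OF vge_delta vge_square[OF that(2) order_refl]]) simp_all
  have eq: "N (lat s0 s1 s2 s3)
      = (s0\<^sup>2 + s0 * s1 - \<delta> * s1\<^sup>2) - pi * (s2\<^sup>2 + s2 * s3 - \<delta> * s3\<^sup>2)"
    by (simp add: lat_def qnorm_def delta power2_eq_square field_simps)
  have "vge v (pi * (s2\<^sup>2 + s2 * s3 - \<delta> * s3\<^sup>2)) (2 * i)"
    by (rule vge_mult_le[OF vge_val bin]) (use assms pi in auto)
  then show ?thesis unfolding eq using bin assms vge_diff by blast
qed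

lemma lattice_span_subset_intD:
  assumes "S \<subseteq> intk v" shows "lattice_span pi Delta S \<subseteq> intD v pi Delta"
proof
  fix q assume "q \<in> lattice_span pi Delta S"
  then obtain s0 s1 s2 s3 where "q = lat s0 s1 s2 s3" "{s0, s1, s2, s3} \<subseteq> S"
    by (auto simp: lattice_span_eq)
  then show "q \<in> intD v pi Delta"
    using vge_norm_lat[of s0 0 s1 s2 s3] assms by (auto simp: intD_def intk_def)
qed

text \<open>Each lattice coordinate of \<open>r\<close> is rounded to its representative;
  \<open>h\<close> is the rounding error.\<close>

lemma lattice_span_approx:
  assumes S: "repr_system v u S" and r: "r \<in> intD v pi Delta"
  obtains h where "qadd r h \<in> lattice_span pi Delta S" "vge v (N h) (2 * u)"
proof -
  obtain x0 x1 x2 x3 where Q: "r = Q x0 x1 x2 x3" by (cases r)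
  have r0: "vge v (N (Q x0 x1 x2 x3)) (2 * 0)" using r by (simp add: intD_def Q)
  have ex: "\<exists>s\<in>S. vge v (s - x) u" if "vge v x 0" for x
  proof -
    have "\<exists>s\<in>S. vge v (x - s) u" using S that by (auto simp: repr_system_def intk_def)
    then show ?thesis using vge_minus[of "_ - x"] by (metis minus_diff_eq)
  qed
  obtain s0 s1 s2 s3 where s: "s0 \<in> S" "s1 \<in> S" "s2 \<in> S" "s3 \<in> S"
    and d: "vge v (s0 - (x0 - x2)) u" "vge v (s1 - 2 * x2) u"
      "vge v (s2 - (x1 - x3)) u" "vge v (s3 - 2 * x3) u"
    using vge_norm_coords[OF r0] ex by metis
  define h where "h = lat (s0 - (x0 - x2)) (s1 - 2 * x2) (s2 - (x1 - x3)) (s3 - 2 * x3)"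
  have "qadd r h = lat s0 s1 s2 s3"
    by (simp add: h_def lat_def qadd_def Q field_simps)
  then show thesis
    using that[of h] s vge_norm_lat[OF d] unfolding h_def lattice_span_eq by blast
qed

subsection \<open>The star conditions\<close>

definition star_vec :: "'k quat \<Rightarrow> 'k quat \<Rightarrow> 'k quat" where
  "star_vec a1 r = qsub a1 (mul (mul r a1) (qconj r))"

lemma kstar_iff:
  assumes "a1 \<noteq> Q 0 0 0 0"
  shows "kstar v pi Delta a1 t r \<longleftrightarrow> \<not> norm_form (N a1) (N (qsub (scal 1) r)) \<and>
    nonzero_square (N (star_vec a1 r) * N a1) \<and> vge v (N (star_vec a1 r)) (2 * t + v (N a1))"
proof -
  have m: "N a1 \<noteq> 0" using assms by (simp add: norm_eq_zero)
  have "N (mul (scal (pi powi t)) a1) = (pi powi t)\<^sup>2 * N a1" by (simp add: qnorm_mult)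
  moreover have "v ((pi powi t)\<^sup>2 * N a1) = 2 * t + v (N a1)" "(pi powi t)\<^sup>2 * N a1 \<noteq> 0"
    using m pi by (simp_all add: val_mult val_square val_power_int)
  ultimately show ?thesis
    using m by (simp add: kstar_def Let_def star_vec_def hilbert_eq_minus_one_iff intk_def
        vge_divide_iff flip: divide_inverse)
qed

lemma kstar_bounds:
  assumes a1: "pure a1" "a1 \<noteq> Q 0 0 0 0" and t: "e \<le> t"
    and star: "kstar v pi Delta a1 t r"
  shows "v (N (star_vec a1 r)) \<le> v (N a1) + 2 * t + 8 * e - 2"
    and "v (N (qsub (scal 1) r)) \<le> 8 * e"
proof -
  define m where "m = N a1"
  have m: "m \<noteq> 0" using a1 by (simp add: norm_eq_zero m_def)
  obtain y1 y2 y3 where A: "a1 = Q 0 y1 y2 y3" using a1 by (cases a1) (simp add: pure_def)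
  obtain x0 x1 x2 x3 where R: "r = Q x0 x1 x2 x3" by (cases r)
  \<comment> \<open>Thus \<open>c1\<close> is the coefficient of \<open>a1\<close> in
    \<open>r\<close>, and \<open>B\<close> below is the norm of the part \<open>d\<close> orthogonal
    to \<open>1\<close> and \<open>a1\<close>.\<close>
  define \<beta> where "\<beta> = pi * Delta * x3 * y3 - pi * x1 * y1 - Delta * x2 * y2"
  define c1 where "c1 = \<beta> / m"
  define n where "n = N r"
  define B where "B = n - x0\<^sup>2 - m * c1\<^sup>2"
  have beta: "\<beta> = m * c1" using m by (simp add: c1_def)
  have nn: "\<not> norm_form m (N (qsub (scal 1) r))" and sq: "nonzero_square (N (star_vec a1 r) * m)"
    using star a1 by (auto simp: kstar_iff m_def)
  have P: "N (qsub (scal 1) r) = 1 + n - 2 * x0"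
    by (simp add: R n_def quat_defs power2_eq_square algebra_simps)
  have "N (star_vec a1 r) = m * ((n - 1)\<^sup>2 + 4 * (n - x0\<^sup>2)) - 4 * \<beta>\<^sup>2"
    unfolding star_vec_def m_def n_def \<beta>_def by (rule qnorm_star_vector[OF A R])
  then have Nz: "N (star_vec a1 r) = m * ((n - 1)\<^sup>2 + 4 * B)"
    by (simp add: beta B_def power2_eq_square algebra_simps)
  obtain w' where "w' \<noteq> 0" "N (star_vec a1 r) * m = w'\<^sup>2"
    using sq unfolding nonzero_square_def by blast
  then have disc: "(w' / m)\<^sup>2 = (n - 1)\<^sup>2 + 4 * B"
    using m Nz by (simp add: field_simps power2_eq_square)
  define w where "w = w' / m"
  have w: "w \<noteq> 0" "w\<^sup>2 = (n - 1)\<^sup>2 + 4 * B"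
    using \<open>w' \<noteq> 0\<close> m disc by (simp_all add: w_def)
  have vz: "v (N (star_vec a1 r)) = v m + 2 * v w"
    unfolding Nz w(2)[symmetric] using m w(1) by (simp add: val_mult val_square)
  have nsq: "\<not> is_square (- B)"
  proof
    assume "is_square (- B)"
    then obtain X where X: "- B = X\<^sup>2" unfolding is_square_def by blast
    \<comment> \<open>This is the norm of \<open>X + d\<close>, namely
      \<open>X\<^sup>2 + B = 0\<close>. Anisotropy gives \<open>B = 0\<close>, and then
      \<open>N(1 - r)\<close> would be a norm.\<close>
    have "N (Q X (x1 - c1 * y1) (x2 - c1 * y2) (x3 - c1 * y3))
        = X\<^sup>2 + (n - x0\<^sup>2) - 2 * c1 * \<beta> + c1\<^sup>2 * m"
      by (simp add: n_def m_def R A \<beta>_def qnorm_def power2_eq_square algebra_simps)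
    also have "\<dots> = X\<^sup>2 + B" by (simp add: beta B_def power2_eq_square algebra_simps)
    also have "\<dots> = 0" using X by (metis neg_eq_iff_add_eq_0 add.commute)
    finally have "X = 0" by (simp add: norm_eq_zero)
    then have "B = 0" using X by simp
    then have "1 + n - 2 * x0 = (1 - x0)\<^sup>2 + m * c1\<^sup>2"
      by (simp add: B_def power2_eq_square algebra_simps)
    then show False using nn P norm_formI by metis
  qed
  have "\<not> vge v w (5 * e)"
    using norm_form_if_deep_discriminant[of w n x0 m c1] w nsq nn P unfolding B_def by auto
  \<comment> \<open>Integrality gives \<open>v w \<le> t + 4 * e - 1\<close>; doubling produces the
    \<open>- 2\<close> of the bound.\<close>
  then have "\<not> vge v w (t + 4 * e)"
    using t by (auto intro: vge_mono)
  then show "v (N (star_vec a1 r)) \<le> v (N a1) + 2 * t + 8 * e - 2"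
    using vz w(1) by (simp add: vge_def m_def)
  show "v (N (qsub (scal 1) r)) \<le> 8 * e"
  proof (rule ccontr)
    assume "\<not> ?thesis"
    then have deep: "vge v (N (qsub (scal 1) r)) (2 * (4 * e))" by (simp add: vge_def)
    have "vge v (2 * (1 - x0)) (4 * e)"
      using vge_trace[OF deep] by (simp add: R quat_defs)
    then show False
      using norm_form_if_deep_norm[of w n x0 m c1] w nn deep unfolding P B_def by simp
  qed
qed

text \<open>Replacing \<open>r\<close> by \<open>r + h\<close> multiplies \<open>N(1 - r)\<close> by
  a nonzero square and \<open>N(z)\<close> by the square of a unit, which preserves all three
  conditions.\<close>

lemma kstar_stable:
  assumes a1: "pure a1" "a1 \<noteq> Q 0 0 0 0" and t: "e \<le> t"
    and r: "r \<in> intD v pi Delta" "kstar v pi Delta a1 t r"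
    and h: "vge v (N h) (2 * (t + 6 * e))"
  shows "kstar v pi Delta a1 t (qadd r h)"
proof -
  note bounds = kstar_bounds[OF a1 t r(2)]
  have nn: "\<not> norm_form (N a1) (N (qsub (scal 1) r))"
    and sq: "nonzero_square (N (star_vec a1 r) * N a1)"
    and dv: "vge v (N (star_vec a1 r)) (2 * t + v (N a1))"
    using r(2) a1 by (auto simp: kstar_iff)
  have "N (qsub (scal 1) r) \<noteq> 0"
    using nn norm_form_square[of "N a1" 0] by auto
  moreover have "vge v (N h) (v (N (qsub (scal 1) r)) + 4 * e + 2)"
    by (rule vge_mono[OF h]) (use bounds t e_pos in simp)
  ultimately obtain y where
    y: "N (qsub (qsub (scal 1) r) h) = N (qsub (scal 1) r) * y\<^sup>2" "y \<noteq> 0"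
    by (rule norm_perturb)
  have "qsub (qsub (scal 1) r) h = qsub (scal 1) (qadd r h)"
    by (cases r; cases h) (simp add: quat_defs)
  then have nn': "\<not> norm_form (N a1) (N (qsub (scal 1) (qadd r h)))"
    using nn y norm_form_cancel[of "N a1" "N (qsub (scal 1) r)" "y\<^sup>2"] norm_form_square by auto
  define q where "q = mul (mul h a1) (qconj r)"
  define g where "g = qadd (qsub q (qconj q)) (mul (mul h a1) (qconj h))"
  have zg: "star_vec a1 (qadd r h) = qsub (star_vec a1 r) g"
    unfolding star_vec_def g_def q_def by (rule star_vector_perturb[OF a1(1)])
  have r0: "vge v (N r) 0" using r(1) by (simp add: intD_def)
  have ha: "vge v (N h * N a1) (2 * (t + 6 * e) + v (N a1))" by (rule vge_mult[OF h vge_val])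
  have Nq: "vge v (N q) (2 * (t + 6 * e) + v (N a1))"
    unfolding q_def qnorm_mult qnorm_conj by (rule vge_mult_le[OF ha r0]) simp
  have "vge v (N g) (2 * (t + 6 * e) + v (N a1))"
    unfolding g_def
  proof (intro vge_norm_add vge_norm_sub)
    show "vge v (N (mul (mul h a1) (qconj h))) (2 * (t + 6 * e) + v (N a1))"
      unfolding qnorm_mult qnorm_conj
      by (rule vge_mult_le[OF ha h]) (use t e_pos in simp)
  qed (simp_all only: qnorm_conj Nq)
  \<comment> \<open>The bound on \<open>N(z)\<close> plus \<open>4 * e + 2\<close> is exactly
    \<open>v (N a1) + 2 * (t + 6 * e)\<close>; this fits the modulus
    \<open>u = t + 6 * e\<close>.\<close>
  then have "vge v (N g) (v (N (star_vec a1 r)) + 4 * e + 2)"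
    by (rule vge_mono) (use bounds in simp)
  moreover have nz: "N (star_vec a1 r) \<noteq> 0" using sq by (auto simp: nonzero_square_def)
  ultimately obtain y' where
    y': "N (star_vec a1 (qadd r h)) = N (star_vec a1 r) * y'\<^sup>2" "y' \<noteq> 0" "v y' = 0"
    unfolding zg by (metis norm_perturb)
  obtain s where s: "s \<noteq> 0" "N (star_vec a1 r) * N a1 = s\<^sup>2"
    using sq unfolding nonzero_square_def by blast
  have "N (star_vec a1 (qadd r h)) * N a1 = (s * y')\<^sup>2"
    using s(2) y'(1) by (simp add: power_mult_distrib algebra_simps)
  then have "nonzero_square (N (star_vec a1 (qadd r h)) * N a1)"
    using s(1) y'(2) unfolding nonzero_square_def by (metis mult_eq_0_iff)
  moreover have "vge v (N (star_vec a1 (qadd r h))) (2 * t + v (N a1))"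
    unfolding y'(1) by (rule vge_mult_le[OF dv vge_square[OF vge_val order_refl]]) (simp add: y'(3))
  ultimately show ?thesis using nn' a1(2) by (simp add: kstar_iff)
qed

end

theorem theorem4:
  fixes v :: "'k::field_char_0 \<Rightarrow> int" and pi Delta :: 'k
    and a1 a2 :: "'k quat" and t :: int and S :: "'k set"
  assumes k: "dyadic_local_field v"
    and pi: "pi \<noteq> 0" "v pi = 1"
    and Delta: "\<exists>\<delta>. unitk v \<delta> \<and> Delta = 1 + 4 * \<delta>" "min_quad_defect_unit v Delta"
    and a1: "pure a1" "a1 \<noteq> Q 0 0 0 0"
    and a2: "pure a2" "a2 \<noteq> Q 0 0 0 0"
    and size: "qnu v pi Delta (qmul pi Delta (scal 2) a1) \<le> qnu v pi Delta a2"
    and sq: "\<exists>y. y \<noteq> 0 \<and> qnorm pi Delta a2 = qnorm pi Delta a1 * y\<^sup>2"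
    and t: "qnu v pi Delta (scal (pi powi t)) = qnu v pi Delta a2 - qnu v pi Delta a1"
    and S: "finite S" "repr_system v (t + 6 * ram_index v) S"
  shows "(\<exists>r \<in> intD v pi Delta. kstar v pi Delta a1 t r) \<longleftrightarrow>
         (\<exists>\<alpha> \<in> lattice_span pi Delta S. kstar v pi Delta a1 t \<alpha>)"
proof -
  obtain \<delta> where \<delta>: "unitk v \<delta>" "Delta = 1 + 4 * \<delta>" using Delta(1) by blast
  interpret dyadic_quaternion v pi \<delta> Delta
    by unfold_locales (use k pi \<delta> Delta(2) in auto)
  have "N a1 \<noteq> 0" using a1 by (simp add: norm_eq_zero)
  \<comment> \<open>Norms double valuations: \<open>size\<close> and \<open>t\<close> combine to
    \<open>2 * v 2 \<le> 2 * t\<close>.\<close>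
  then have te: "v 2 \<le> t"
    using size t pi by (simp add: qnu_def qnorm_mult val_mult val_square val_power_int)
  show ?thesis
  proof
    assume "\<exists>r \<in> intD v pi Delta. kstar v pi Delta a1 t r"
    then obtain r where r: "r \<in> intD v pi Delta" "kstar v pi Delta a1 t r" by blast
    obtain h where "qadd r h \<in> lattice_span pi Delta S" "vge v (N h) (2 * (t + 6 * v 2))"
      using lattice_span_approx[OF S(2) r(1)] by (auto simp: ram_index_def)
    then show "\<exists>\<alpha> \<in> lattice_span pi Delta S. kstar v pi Delta a1 t \<alpha>"
      using kstar_stable[OF a1 te r] by blast
  next
    assume "\<exists>\<alpha> \<in> lattice_span pi Delta S. kstar v pi Delta a1 t \<alpha>"
    then show "\<exists>r \<in> intD v pi Delta. kstar v pi Delta a1 t r"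
      using lattice_span_subset_intD S(2) unfolding repr_system_def by blast
  qed
qed

end
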